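(* Let $L$ be a finite planar modular lattice with bottom element $0$, top element $1$, and at least two elements, such that $\{0,1\}\nsubseteq B(L)$, where $B(L)$ is the set of bi-irreducible elements of $L$. Let $C_l$ and $C_r$ be the left and right boundary chains of $L$ (with respect to a planar diagram of $L$), and suppose that at least one of $C_l$, $C_r$ contains exactly one bi-irreducible element of $L$. Then $L$ is $1$-distributive if and only if there exists a $\vee$-distributive pseudo-t-norm on $L$.
   Context: Planar: a finite lattice is planar if it has a Hasse diagram drawn in the plane in which no two of the straight line segments cross. For a fixed planar diagram, the left (resp. right) boundary chain is the maximal chain from $0$ to $1$ forming the left (resp. right) boundary of the diagram, i.e. no element of $L$ lies strictly to its left (resp. right). Bi-irreducible: $q\in L$ is join-irreducible if $q=x\vee y$ implies $q=x$ or $q=y$, and meet-irreducible if $q=x\wedge y$ implies $q=x$ or $q=y$; it is bi-irreducible if it is both. (Under this definition $0$ is always join-irreducible and $1$ is always meet-irreducible.) $1$-distributive: $L$ is $1$-distributive if for all $a,b,c\in L$, $a\vee b=1$ implies $c\wedge(a\vee b)=(c\wedge a)\vee(c\wedge b)$. Pseudo-t-norm: a binary operation $T:L^2\to L$ on a bounded lattice $L$ such that for all $a,b,c\in L$: $T(1,a)=a$ and $T(0,a)=0$; $b\le c$ implies $T(a,b)\le T(a,c)$; and (standing convention) $T(a,b)=T(b,a)$. It is $\vee$-distributive if $T(a,b\vee c)=T(a,b)\vee T(a,c)$ for all $a,b,c\in L$. *)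

theory Defs
  imports "HOL-Analysis.Analysis"
begin

unbundle lattice_syntax

text \<open>
  Lattices are types of class \<open>{finite, bounded_lattice}\<close>; properties of the whole lattice take
  the type as an \<open>itself\<close> argument.
\<close>

definition modular_lattice :: "'a::lattice itself \<Rightarrow> bool" where
  "modular_lattice _ \<longleftrightarrow> (\<forall>a b c :: 'a. a \<le> c \<longrightarrow> a \<squnion> (b \<sqinter> c) = (a \<squnion> b) \<sqinter> c)"

definition one_distributive :: "'a::bounded_lattice itself \<Rightarrow> bool" where
  "one_distributive _ \<longleftrightarrow>
     (\<forall>a b c :: 'a. a \<squnion> b = \<top> \<longrightarrow> c \<sqinter> (a \<squnion> b) = (c \<sqinter> a) \<squnion> (c \<sqinter> b))"

text \<open>With the next two definitions \<open>\<bottom>\<close> is join-irreducible and \<open>\<top>\<close> is meet-irreducible.\<close>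

definition join_irreducible :: "'a::lattice \<Rightarrow> bool" where
  "join_irreducible q \<longleftrightarrow> (\<forall>x y. q = x \<squnion> y \<longrightarrow> q = x \<or> q = y)"

definition meet_irreducible :: "'a::lattice \<Rightarrow> bool" where
  "meet_irreducible q \<longleftrightarrow> (\<forall>x y. q = x \<sqinter> y \<longrightarrow> q = x \<or> q = y)"

definition bi_irreducibles :: "'a::lattice set" where
  "bi_irreducibles = {q. join_irreducible q \<and> meet_irreducible q}"

definition pseudo_t_norm :: "('a::bounded_lattice \<Rightarrow> 'a \<Rightarrow> 'a) \<Rightarrow> bool" where
  "pseudo_t_norm T \<longleftrightarrow>
     (\<forall>a. T \<top> a = a) \<and> (\<forall>a. T \<bottom> a = \<bottom>) \<and>
     (\<forall>a b c. b \<le> c \<longrightarrow> T a b \<le> T a c) \<and>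
     (\<forall>a b. T a b = T b a)"

definition join_distributive :: "('a::lattice \<Rightarrow> 'a \<Rightarrow> 'a) \<Rightarrow> bool" where
  "join_distributive T \<longleftrightarrow> (\<forall>a b c. T a (b \<squnion> c) = T a b \<squnion> T a c)"

definition covered_by :: "'a::order \<Rightarrow> 'a \<Rightarrow> bool" where
  "covered_by a b \<longleftrightarrow> a < b \<and> (\<nexists>c. a < c \<and> c < b)"

text \<open>
  A Hasse diagram places every element at a point of the plane, larger elements strictly higher,
  and joins each covering pair by a straight line segment. As usual, a segment passes through
  no element other than its two end points.
\<close>

definition hasse_diagram :: "('a::order \<Rightarrow> real \<times> real) \<Rightarrow> bool" where
  "hasse_diagram pos \<longleftrightarrow>
     inj pos \<and>
     (\<forall>a b. a < b \<longrightarrow> snd (pos a) < snd (pos b)) \<and>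
     (\<forall>a b c. covered_by a b \<longrightarrow> pos c \<notin> open_segment (pos a) (pos b))"

text \<open>
  Comparing open segments suffices: in a Hasse diagram distinct edges with disjoint open
  segments can meet only in a common end point.
\<close>

definition planar_diagram :: "('a::order \<Rightarrow> real \<times> real) \<Rightarrow> bool" where
  "planar_diagram pos \<longleftrightarrow>
     hasse_diagram pos \<and>
     (\<forall>a b c d. covered_by a b \<longrightarrow> covered_by c d \<longrightarrow> (a, b) \<noteq> (c, d) \<longrightarrow>
        open_segment (pos a) (pos b) \<inter> open_segment (pos c) (pos d) = {})"

text \<open>
  The drawing of a maximal chain is a polygonal line which, in a finite lattice, has exactly one
  point at each height between \<open>\<bottom>\<close> and \<open>\<top>\<close>. Hence an element lies strictly to the left
  (right) of the chain iff it is strictly to the left (right) of the point at its own height.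
\<close>

definition chain_path :: "('a::order \<Rightarrow> real \<times> real) \<Rightarrow> 'a set \<Rightarrow> (real \<times> real) set" where
  "chain_path pos C =
     \<Union>{closed_segment (pos a) (pos b) | a b. a \<in> C \<and> b \<in> C \<and> covered_by a b}"

definition strictly_left_of :: "('a::order \<Rightarrow> real \<times> real) \<Rightarrow> 'a set \<Rightarrow> 'a \<Rightarrow> bool" where
  "strictly_left_of pos C q \<longleftrightarrow>
     (\<exists>z \<in> chain_path pos C. snd z = snd (pos q) \<and> fst (pos q) < fst z)"

definition strictly_right_of :: "('a::order \<Rightarrow> real \<times> real) \<Rightarrow> 'a set \<Rightarrow> 'a \<Rightarrow> bool" where
  "strictly_right_of pos C q \<longleftrightarrow>
     (\<exists>z \<in> chain_path pos C. snd z = snd (pos q) \<and> fst z < fst (pos q))"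

text \<open>In a finite bounded lattice a maximal chain contains \<open>\<bottom>\<close> and \<open>\<top>\<close>.\<close>

definition left_boundary_chain :: "('a::order \<Rightarrow> real \<times> real) \<Rightarrow> 'a set \<Rightarrow> bool" where
  "left_boundary_chain pos C \<longleftrightarrow>
     pred_on.maxchain UNIV (<) C \<and> (\<forall>q. \<not> strictly_left_of pos C q)"

definition right_boundary_chain :: "('a::order \<Rightarrow> real \<times> real) \<Rightarrow> 'a set \<Rightarrow> bool" where
  "right_boundary_chain pos C \<longleftrightarrow>
     pred_on.maxchain UNIV (<) C \<and> (\<forall>q. \<not> strictly_right_of pos C q)"

end

theory Submission
  imports Defs
begin

text \<open>
  A join-distributive pseudo-t-norm \<open>T\<close> satisfies \<open>T x y \<le> x \<sqinter> y\<close>, and expanding \<open>c = T c (a \<squnion> b)\<close> for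
  \<open>a \<squnion> b = \<top>\<close> gives 1-distributivity. For the converse assume that \<open>\<top>\<close> is join-reducible (otherwise
  the drastic product works) and, reflecting the diagram if necessary, that the left boundary \<open>C\<close>
  has one bi-irreducible element. Let \<open>p\<close> be the coatom on \<open>C\<close> and \<open>q\<close> another one. By
  1-distributivity there are a least \<open>a\<close> not below \<open>q\<close> and a least \<open>b\<close> not below \<open>p\<close>; both are
  join-prime. By planarity every join-irreducible element of \<open>C\<close> whose upper cover in \<open>C\<close> is
  join-reducible is bi-irreducible. Hence \<open>a\<close> lies on \<open>C\<close>, there is no third coatom (so
  \<open>a \<squnion> b = \<top>\<close>), and, as only one bi-irreducible element is available, all elements of \<open>C\<close> up to \<open>a\<close>
  are join-irreducible, i.e. the ideal below \<open>a\<close> is a chain. Modularity then makes \<open>g x = x \<sqinter> b\<close> and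
  \<open>f x = (if x \<le> b then \<bottom> else x \<sqinter> a)\<close> join-endomorphisms with \<open>f x \<squnion> g x = x\<close>, and the join of
  \<open>f y\<close> if \<open>a \<le> x\<close>, \<open>g y\<close> if \<open>b \<le> x\<close>, \<open>f x\<close> if \<open>a \<le> y\<close>, \<open>g x\<close> if \<open>b \<le> y\<close> is the required operation.
\<close>

subsection \<open>Pseudo-t-norms from join-endomorphisms\<close>

lemma pseudo_t_norm_imp_one_distributive:
  fixes T :: "'a::bounded_lattice \<Rightarrow> 'a \<Rightarrow> 'a"
  assumes "pseudo_t_norm T" and "join_distributive T"
  shows "one_distributive TYPE('a)"
  unfolding one_distributive_def
proof (intro allI impI)
  fix a b c :: 'a
  assume ab: "a \<squnion> b = \<top>"
  have one: "T \<top> x = x" and mono: "y \<le> z \<Longrightarrow> T x y \<le> T x z" and comm: "T x y = T y x"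
    for x y z
    using assms(1) unfolding pseudo_t_norm_def by blast+
  have le: "T x y \<le> x \<sqinter> y" for x y
    using mono[of y \<top> x] mono[of x \<top> y] one comm by (metis le_inf_iff top_greatest)
  have "c = T c (a \<squnion> b)"
    using ab one comm by metis
  also have "\<dots> = T c a \<squnion> T c b"
    using assms(2) unfolding join_distributive_def by blast
  also have "\<dots> \<le> (c \<sqinter> a) \<squnion> (c \<sqinter> b)"
    by (intro sup_mono le)
  finally have "c \<le> (c \<sqinter> a) \<squnion> (c \<sqinter> b)" .
  then show "c \<sqinter> (a \<squnion> b) = (c \<sqinter> a) \<squnion> (c \<sqinter> b)"
    unfolding ab by (intro antisym) auto
qed

lemma join_distributive_pseudo_t_norm_if_top_join_irreducible:
  assumes "join_irreducible (\<top> :: 'a::bounded_lattice)"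
  shows "\<exists>T :: 'a \<Rightarrow> 'a \<Rightarrow> 'a. pseudo_t_norm T \<and> join_distributive T"
proof -
  define T :: "'a \<Rightarrow> 'a \<Rightarrow> 'a" where
    "T x y = (if x = \<top> then y else if y = \<top> then x else \<bottom>)" for x y
  have irr: "x = \<top> \<or> y = \<top>" if "x \<squnion> y = \<top>" for x y :: 'a
    using assms that unfolding join_irreducible_def by metis
  have "pseudo_t_norm T"
    unfolding pseudo_t_norm_def T_def
    by (auto simp: top_unique) (metis bot_least top_unique)
  moreover have "join_distributive T"
    unfolding join_distributive_def T_def using irr by auto
  ultimately show ?thesis by blast
qed

text \<open>Equivalently, \<open>\<lambda>x. a \<le> x\<close> is a homomorphism of
  join-semilattices with bottom into the two-element lattice.\<close>

definition join_prime :: "'a::bounded_lattice \<Rightarrow> bool" where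
  "join_prime a \<longleftrightarrow> a \<noteq> \<bottom> \<and> (\<forall>x y. a \<le> x \<squnion> y \<longleftrightarrow> a \<le> x \<or> a \<le> y)"

text \<open>Each of the four terms of \<open>T\<close> is a join-endomorphism in one argument,
  switched by a join-prime test on the other, so it preserves joins in both. At
  \<open>x = \<top>\<close> the first two terms give \<open>y\<close>; the last two stay below it
  because \<open>f \<top> \<le> a\<close> and \<open>g \<top> \<le> b\<close>.\<close>

lemma pseudo_t_norm_of_join_endomorphisms:
  fixes f g :: "'a::bounded_lattice \<Rightarrow> 'a"
  assumes f: "\<And>x y. f (x \<squnion> y) = f x \<squnion> f y" and g: "\<And>x y. g (x \<squnion> y) = g x \<squnion> g y"
    and fg: "\<And>x. f x \<squnion> g x = x"
    and "f \<top> \<le> a" and "g \<top> \<le> b" and "join_prime a" and "join_prime b"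
  shows "\<exists>T :: 'a \<Rightarrow> 'a \<Rightarrow> 'a. pseudo_t_norm T \<and> join_distributive T"
proof -
  define T where "T x y =
    (if a \<le> x then f y else \<bottom>) \<squnion> (if b \<le> x then g y else \<bottom>) \<squnion>
    (if a \<le> y then f x else \<bottom>) \<squnion> (if b \<le> y then g x else \<bottom>)" for x y
  have a: "a \<le> x \<squnion> y \<longleftrightarrow> a \<le> x \<or> a \<le> y" and b: "b \<le> x \<squnion> y \<longleftrightarrow> b \<le> x \<or> b \<le> y" for x y
    using assms(6,7) unfolding join_prime_def by auto
  have nz: "\<not> a \<le> \<bottom>" "\<not> b \<le> \<bottom>"
    using assms(6,7) unfolding join_prime_def by (auto simp: bot_unique)
  have bot: "f \<bottom> = \<bottom>" "g \<bottom> = \<bottom>"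
    using fg[of \<bottom>] by (metis sup_bot.eq_neutr_iff)+
  have comm: "T x y = T y x" for x y
    unfolding T_def by (simp add: ac_simps)
  have dist: "T x (y \<squnion> z) = T x y \<squnion> T x z" for x y z
    unfolding T_def a b f g
    by (intro antisym) (auto simp: le_supI1 le_supI2)
  have "T \<top> y = y" for y
  proof -
    have "a \<le> y \<Longrightarrow> f \<top> \<le> y" "b \<le> y \<Longrightarrow> g \<top> \<le> y"
      using assms(4,5) by (auto intro: order_trans)
    then show ?thesis
      unfolding T_def using fg[of y] by (auto simp: sup_absorb1)
  qed
  moreover have "T \<bottom> y = \<bottom>" for y
    unfolding T_def using nz bot by simp
  moreover have "T x y \<le> T x z" if "y \<le> z" for x y z
    using dist[of x y z] that by (metis sup.absorb2 sup.cobounded1)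
  ultimately show ?thesis
    using comm dist unfolding pseudo_t_norm_def join_distributive_def by blast
qed

text \<open>Comparability below \<open>a\<close> makes the join of two \<open>a\<close>-parts equal
  to one of them; the modular law then moves meets with \<open>a\<close> or \<open>b\<close> inside
  joins.\<close>

lemma pseudo_t_norm_of_chain_ideal:
  fixes a b :: "'a::bounded_lattice"
  assumes modular: "modular_lattice TYPE('a)"
    and split: "\<And>x. (x \<sqinter> a) \<squnion> (x \<sqinter> b) = x"
    and prime: "join_prime a" "join_prime b"
    and chain: "\<And>x y. x \<le> a \<Longrightarrow> y \<le> a \<Longrightarrow> x \<le> y \<or> y \<le> x"
  shows "\<exists>T :: 'a \<Rightarrow> 'a \<Rightarrow> 'a. pseudo_t_norm T \<and> join_distributive T"
proof -
  have mod: "(x \<squnion> y) \<sqinter> z = x \<squnion> (y \<sqinter> z)" if "x \<le> z" for x y z :: 'a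
    using modular that unfolding modular_lattice_def by metis
  \<comment> \<open>\<open>\<lambda>x. x \<sqinter> a\<close> itself need not preserve joins of elements below \<open>b\<close>; above \<open>a \<sqinter> b\<close> it does.\<close>
  define f where "f x = (if x \<le> b then \<bottom> else x \<sqinter> a)" for x
  define g where "g x = x \<sqinter> b" for x
  define m where "m x y = (x \<sqinter> a) \<squnion> (y \<sqinter> a)" for x y
  define s where "s x y = (x \<sqinter> b) \<squnion> (y \<sqinter> b)" for x y
  have ms: "x \<squnion> y = m x y \<squnion> s x y" for x y
    using split[of x] split[of y] unfolding m_def s_def by (metis sup.assoc sup.commute)
  have m_cases: "m x y = x \<sqinter> a \<or> m x y = y \<sqinter> a" for x y
    unfolding m_def using chain[of "x \<sqinter> a" "y \<sqinter> a"] by (auto simp: sup_absorb1 sup_absorb2)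
  have g: "g (x \<squnion> y) = g x \<squnion> g y" for x y
  proof -
    have "m x y \<sqinter> b \<le> s x y"
      using m_cases[of x y] unfolding s_def
      by (auto simp: le_supI1 le_supI2 le_infI1)
    moreover have "(s x y \<squnion> m x y) \<sqinter> b = s x y \<squnion> (m x y \<sqinter> b)"
      by (rule mod) (simp add: s_def)
    ultimately show ?thesis
      unfolding g_def ms[of x y] s_def[symmetric] by (simp add: sup_commute sup_absorb1)
  qed
  \<comment> \<open>If \<open>x \<sqinter> a\<close> were below \<open>b\<close>, both parts of
    \<open>x\<close> and hence \<open>x\<close> would be; comparability below \<open>a\<close> then
    reverses the inequality.\<close>
  have not_le: "a \<sqinter> b \<le> x \<sqinter> a" if "\<not> x \<le> b" for x
  proof -
    have "\<not> x \<sqinter> a \<le> a \<sqinter> b"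
      using split[of x] that by (metis inf.bounded_iff inf.cobounded2 le_supI)
    then show ?thesis
      using chain[of "x \<sqinter> a" "a \<sqinter> b"] by auto
  qed
  have ma: "(x \<squnion> y) \<sqinter> a = m x y" if "\<not> (x \<le> b \<and> y \<le> b)" for x y
  proof -
    have "s x y \<sqinter> a \<le> a \<sqinter> b"
      unfolding s_def by (simp add: le_infI1)
    also have "a \<sqinter> b \<le> m x y"
      using that not_le[of x] not_le[of y] unfolding m_def by (auto intro: le_supI1 le_supI2)
    finally have "s x y \<sqinter> a \<le> m x y" .
    moreover have "(m x y \<squnion> s x y) \<sqinter> a = m x y \<squnion> (s x y \<sqinter> a)"
      by (rule mod) (simp add: m_def)
    ultimately show ?thesis
      unfolding ms[of x y] by (simp add: sup_absorb1)
  qed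
  have absorb: "(x \<sqinter> a) \<squnion> (y \<sqinter> a) = x \<sqinter> a" if "\<not> x \<le> b" "y \<le> b" for x y
  proof -
    have "y \<sqinter> a \<le> a \<sqinter> b" using that by (simp add: le_infI1)
    then show ?thesis using not_le[OF that(1)] by (metis order_trans sup_absorb1)
  qed
  have f: "f (x \<squnion> y) = f x \<squnion> f y" for x y
    unfolding f_def using ma[of x y] absorb[of x y] absorb[of y x]
    by (auto simp: m_def sup_commute)
  show ?thesis
  proof (rule pseudo_t_norm_of_join_endomorphisms[where f = f and g = g and a = a and b = b])
    show "f x \<squnion> g x = x" for x
      using split[of x] unfolding f_def g_def by (auto simp: inf_absorb1)
  qed (use f g prime in \<open>auto simp: f_def g_def\<close>)
qed

subsection \<open>Maximal chains\<close>

abbreviation maximal_chain :: "'a::order set \<Rightarrow> bool" where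
  "maximal_chain \<equiv> pred_on.maxchain UNIV (<)"

lemma maximal_chain_linear:
  assumes "maximal_chain C" "x \<in> C" "y \<in> C"
  shows "x \<le> y \<or> y \<le> x"
proof -
  have "\<forall>x\<in>C. \<forall>y\<in>C. (<)\<^sup>=\<^sup>= x y \<or> (<)\<^sup>=\<^sup>= y x"
    using assms(1) unfolding pred_on.maxchain_def pred_on.chain_def by (rule conjunct2[OF conjunct1])
  then show ?thesis using assms(2,3) by fastforce
qed

lemma maximal_chain_memI:
  assumes C: "maximal_chain C" and "\<And>x. x \<in> C \<Longrightarrow> x \<le> z \<or> z \<le> x"
  shows "z \<in> C"
proof (rule ccontr)
  assume "z \<notin> C"
  moreover have "pred_on.chain UNIV (<) (insert z C)"
    using assms maximal_chain_linear[OF C] unfolding pred_on.chain_def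
    by (auto simp: le_less)
  ultimately show False
    using C unfolding pred_on.maxchain_def by blast
qed

lemma maximal_chain_bounds:
  assumes "maximal_chain (C :: 'a::bounded_lattice set)"
  shows "\<bottom> \<in> C" "\<top> \<in> C"
  using assms by (auto intro: maximal_chain_memI)

lemma maximal_chain_extends:
  fixes S :: "'a::{finite, order} set"
  assumes "\<And>x y. x \<in> S \<Longrightarrow> y \<in> S \<Longrightarrow> x \<le> y \<or> y \<le> x"
  shows "\<exists>C. maximal_chain C \<and> S \<subseteq> C"
proof -
  have "S \<in> Collect (pred_on.chain UNIV (<))"
    using assms unfolding pred_on.chain_def by (auto simp: le_less)
  then obtain C where "pred_on.chain UNIV (<) C" "S \<subseteq> C"
    and "\<And>D. pred_on.chain UNIV (<) D \<Longrightarrow> C \<subseteq> D \<Longrightarrow> C = D"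
    using finite_has_maximal2[of "Collect (pred_on.chain UNIV (<))" S] by auto
  then show ?thesis
    unfolding pred_on.maxchain_def by blast
qed

text \<open>The largest element of \<open>C\<close> below \<open>x\<close> is covered by
  \<open>x\<close> in the whole order: anything strictly between would be comparable with all of
  \<open>C\<close>, hence on \<open>C\<close>.\<close>

lemma maximal_chain_lower_cover:
  fixes C :: "'a::{finite, order} set"
  assumes C: "maximal_chain C" and "x \<in> C" and "\<exists>c\<in>C. c < x"
  shows "\<exists>c\<in>C. covered_by c x"
proof -
  obtain c where c: "c \<in> C" "c < x" and max: "\<And>d. d \<in> C \<Longrightarrow> d < x \<Longrightarrow> c \<le> d \<Longrightarrow> c = d"
    using finite_has_maximal[of "{c\<in>C. c < x}"] assms(3) by auto
  have "\<not> (c < z \<and> z < x)" for z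
  proof
    assume z: "c < z \<and> z < x"
    have "z \<in> C"
    proof (rule maximal_chain_memI[OF C])
      fix y assume y: "y \<in> C"
      then have "y \<le> c \<or> x \<le> y"
        using max maximal_chain_linear[OF C y] c \<open>x \<in> C\<close> by (metis order.strict_iff_order)
      then show "y \<le> z \<or> z \<le> y" using z by auto
    qed
    then show False using max z by (metis order.strict_iff_order)
  qed
  then show ?thesis using c unfolding covered_by_def by blast
qed

lemma maximal_chain_upper_cover:
  fixes C :: "'a::{finite, order} set"
  assumes C: "maximal_chain C" and "x \<in> C" and "\<exists>c\<in>C. x < c"
  shows "\<exists>c\<in>C. covered_by x c"
proof -
  obtain c where c: "c \<in> C" "x < c" and min: "\<And>d. d \<in> C \<Longrightarrow> x < d \<Longrightarrow> d \<le> c \<Longrightarrow> c = d"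
    using finite_has_minimal[of "{c\<in>C. x < c}"] assms(3) by auto
  have "\<not> (x < z \<and> z < c)" for z
  proof
    assume z: "x < z \<and> z < c"
    have "z \<in> C"
    proof (rule maximal_chain_memI[OF C])
      fix y assume y: "y \<in> C"
      then have "y \<le> x \<or> c \<le> y"
        using min maximal_chain_linear[OF C y] c \<open>x \<in> C\<close> by (metis order.strict_iff_order)
      then show "y \<le> z \<or> z \<le> y" using z by auto
    qed
    then show False using min z by (metis order.strict_iff_order)
  qed
  then show ?thesis using c unfolding covered_by_def by blast
qed

lemma covered_by_exists:
  fixes x y :: "'a::{finite, order}"
  assumes "x < y"
  shows "\<exists>c. covered_by x c \<and> c \<le> y" "\<exists>c. covered_by c y \<and> x \<le> c"
proof -
  obtain C where C: "maximal_chain C" "{x, y} \<subseteq> C"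
    using maximal_chain_extends[of "{x, y}"] assms
    by (metis insert_iff less_imp_le order_refl singletonD)
  obtain c where "c \<in> C" "covered_by x c"
    using maximal_chain_upper_cover[of C x] C assms by auto
  then show "\<exists>c. covered_by x c \<and> c \<le> y"
    using maximal_chain_linear[OF C(1), of c y] C assms unfolding covered_by_def by fastforce
  obtain c where "c \<in> C" "covered_by c y"
    using maximal_chain_lower_cover[of C y] C assms by auto
  then show "\<exists>c. covered_by c y \<and> x \<le> c"
    using maximal_chain_linear[OF C(1), of c x] C assms unfolding covered_by_def by fastforce
qed

section \<open>Coatoms in 1-distributive lattices\<close>

lemma coatom_least_not_below:
  fixes q :: "'a::{finite, bounded_lattice}"
  assumes od: "one_distributive TYPE('a)" and q: "covered_by q \<top>"
  obtains a where "\<And>x. a \<le> x \<longleftrightarrow> \<not> x \<le> q"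
proof -
  have join: "x \<squnion> q = \<top>" if "\<not> x \<le> q" for x
  proof -
    have "q < x \<squnion> q" using that by (simp add: less_le_not_le)
    then have "\<not> x \<squnion> q < \<top>" using q unfolding covered_by_def by blast
    then show ?thesis by (simp add: less_le)
  qed
  \<comment> \<open>As \<open>y \<squnion> q = \<top>\<close>, 1-distributivity splits
    \<open>x\<close> into \<open>x \<sqinter> y\<close> and \<open>x \<sqinter> q\<close>, not both
    below \<open>q\<close>. Elements not below \<open>q\<close> are thus closed under meets, and a
    minimal one is least.\<close>
  have meet: "\<not> x \<sqinter> y \<le> q" if "\<not> x \<le> q" "\<not> y \<le> q" for x y
  proof
    assume "x \<sqinter> y \<le> q"
    moreover have "x \<sqinter> (y \<squnion> q) = (x \<sqinter> y) \<squnion> (x \<sqinter> q)"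
      using od join[OF that(2)] unfolding one_distributive_def by blast
    then have "x = (x \<sqinter> y) \<squnion> (x \<sqinter> q)"
      using join[OF that(2)] by simp
    ultimately show False
      using that(1) by (metis inf_le2 le_supI)
  qed
  have "\<top> \<in> {x. \<not> x \<le> q}"
    using q unfolding covered_by_def by (auto simp: top_unique)
  then obtain a where a: "\<not> a \<le> q" and min: "\<And>x. \<not> x \<le> q \<Longrightarrow> x \<le> a \<Longrightarrow> a = x"
    using finite_has_minimal[of "{x. \<not> x \<le> q}"] by auto
  have "a \<le> x \<longleftrightarrow> \<not> x \<le> q" for x
  proof
    show "\<not> x \<le> q" if "a \<le> x"
      using a order_trans[OF that] by blast
    show "a \<le> x" if "\<not> x \<le> q"
      using min[OF meet[OF a that]] by (metis inf_le1 inf_le2)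
  qed
  then show ?thesis using that by blast
qed

lemma join_prime_if_least_not_below:
  assumes "\<And>x. a \<le> x \<longleftrightarrow> \<not> x \<le> q"
  shows "join_prime a"
proof -
  have "a \<noteq> \<bottom>" using assms[of a] by auto
  then show ?thesis
    unfolding join_prime_def by (simp add: assms)
qed

section \<open>Bi-irreducible elements on a boundary chain\<close>

text \<open>
  Replacing the edge \<open>c c'\<close> of a left boundary chain by \<open>w c'\<close> gives a chain that separates \<open>c\<close> from
  everything to its right, so that an element above \<open>c\<close> can only be reached through \<open>c'\<close>. This is
  all that the combinatorial part of the argument needs to know about planarity.
\<close>

definition forced_upward :: "'a::order set \<Rightarrow> bool" where
  "forced_upward C \<longleftrightarrow>
     (\<forall>c\<in>C. \<forall>c'\<in>C. \<forall>w y. covered_by c c' \<longrightarrow> covered_by w c' \<longrightarrow> w \<noteq> c \<longrightarrow> c < y \<longrightarrow> c' \<le> y)"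

text \<open>With no lower cover besides \<open>c\<close>, everything strictly below
  \<open>c'\<close> would lie below \<open>c\<close>, including two elements whose join is
  \<open>c'\<close>.\<close>

lemma join_reducible_other_lower_cover:
  fixes c c' :: "'a::{finite, lattice}"
  assumes "\<not> join_irreducible c'"
  shows "\<exists>w. covered_by w c' \<and> w \<noteq> c"
proof (rule ccontr)
  assume "\<nexists>w. covered_by w c' \<and> w \<noteq> c"
  then have le: "x \<le> c" if "x < c'" for x
    using covered_by_exists(2)[OF that] by auto
  obtain x y where xy: "c' = x \<squnion> y" "c' \<noteq> x" "c' \<noteq> y"
    using assms unfolding join_irreducible_def by blast
  then have lt: "x < c'" "y < c'" by (simp_all add: less_le)
  obtain w where "covered_by w c'" using covered_by_exists(2)[OF lt(1)] by blast
  then have "covered_by c c'" using \<open>\<nexists>w. covered_by w c' \<and> w \<noteq> c\<close> by blast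
  then have "c < c'" unfolding covered_by_def by blast
  then show False using le lt xy by (metis le_supI leD)
qed

text \<open>A join-reducible \<open>c'\<close> has a second lower cover, so everything strictly
  above \<open>c\<close> is above \<open>c'\<close>, and meets of such elements cannot drop to
  \<open>c\<close>.\<close>

lemma bi_irreducible_below_join_reducible:
  fixes C :: "'a::{finite, lattice} set"
  assumes "forced_upward C" "c \<in> C" "c' \<in> C" "covered_by c c'"
    and "join_irreducible c" "\<not> join_irreducible c'"
  shows "c \<in> bi_irreducibles"
proof -
  obtain w where w: "covered_by w c'" "w \<noteq> c"
    using join_reducible_other_lower_cover[OF assms(6)] by blast
  have "c < c'" using assms(4) unfolding covered_by_def by simp
  have "meet_irreducible c"
    unfolding meet_irreducible_def
  proof (intro allI impI)
    fix x y assume c: "c = x \<sqinter> y"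
    show "c = x \<or> c = y"
    proof (rule ccontr)
      assume "\<not> (c = x \<or> c = y)"
      then have "c < x" "c < y" using c by (auto simp: less_le)
      then have "c' \<le> x" "c' \<le> y"
        using assms(1-4) w unfolding forced_upward_def by blast+
      then show False using c \<open>c < c'\<close> by (metis le_inf_iff leD)
    qed
  qed
  then show ?thesis using assms(5) unfolding bi_irreducibles_def by simp
qed

text \<open>Take the largest join-irreducible element of \<open>C\<close> from \<open>x\<close> to
  below \<open>y\<close>: by maximality its upper cover on \<open>C\<close> is
  join-reducible.\<close>

lemma bi_irreducible_between:
  fixes C :: "'a::{finite, lattice} set"
  assumes C: "maximal_chain C" and fwd: "forced_upward C"
    and x: "x \<in> C" "join_irreducible x" and y: "y \<in> C" "\<not> join_irreducible y" and "x < y"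
  shows "\<exists>k\<in>C \<inter> bi_irreducibles. x \<le> k \<and> k < y"
proof -
  obtain k where k: "k \<in> C" "x \<le> k" "k < y" "join_irreducible k"
    and max: "\<And>d. d \<in> C \<Longrightarrow> x \<le> d \<Longrightarrow> d < y \<Longrightarrow> join_irreducible d \<Longrightarrow> k \<le> d \<Longrightarrow> k = d"
    using finite_has_maximal[of "{d\<in>C. x \<le> d \<and> d < y \<and> join_irreducible d}"] x \<open>x < y\<close> by auto
  obtain k' where k': "k' \<in> C" "covered_by k k'"
    using maximal_chain_upper_cover[OF C k(1)] y k by blast
  then have lt: "k < k'" and "\<not> y < k'" using k unfolding covered_by_def by auto
  then have "k' \<le> y" using maximal_chain_linear[OF C k'(1) y(1)] by auto
  have "\<not> join_irreducible k'"
    using max[OF k'(1)] \<open>k' \<le> y\<close> lt k y(2) by (metis order.strict_iff_order order_trans)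
  then have "k \<in> bi_irreducibles"
    using bi_irreducible_below_join_reducible[OF fwd k(1) k'] k by blast
  then show ?thesis using k by blast
qed

text \<open>The candidate is the least \<open>c'\<close> on \<open>C\<close> not below
  \<open>q\<close>, with lower cover \<open>c\<close> on \<open>C\<close>. A second lower cover of
  \<open>c'\<close> would force \<open>c' \<le> q\<close>, since \<open>c < q\<close>. So
  \<open>c'\<close> is join-irreducible, and \<open>c' = c \<squnion> a\<close> yields
  \<open>c' = a\<close>.\<close>

lemma least_not_below_coatom_in_chain:
  fixes C :: "'a::{finite, bounded_lattice} set"
  assumes C: "maximal_chain C" and fwd: "forced_upward C"
    and q: "covered_by q \<top>" "q \<notin> C" and a: "\<And>x. a \<le> x \<longleftrightarrow> \<not> x \<le> q"
  shows "a \<in> C" "join_irreducible a"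
proof -
  have "q < \<top>" using q unfolding covered_by_def by simp
  obtain c' where c': "c' \<in> C" "\<not> c' \<le> q"
    and min: "\<And>d. d \<in> C \<Longrightarrow> \<not> d \<le> q \<Longrightarrow> d \<le> c' \<Longrightarrow> c' = d"
    using finite_has_minimal[of "{c\<in>C. \<not> c \<le> q}"] maximal_chain_bounds(2)[OF C] \<open>q < \<top>\<close>
    by auto (metis leD)
  have "\<bottom> < c'" using c'(2) by (metis bot.not_eq_extremum bot_least)
  then obtain c where c: "c \<in> C" "covered_by c c'"
    using maximal_chain_lower_cover[OF C c'(1)] maximal_chain_bounds(1)[OF C] by blast
  then have "c < c'" unfolding covered_by_def by simp
  then have "c \<le> q" using min[OF c(1)] by force
  with c(1) q(2) have "c < q" by (auto simp: less_le)
  have irr: "join_irreducible c'"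
  proof (rule ccontr)
    assume "\<not> join_irreducible c'"
    then obtain w where "covered_by w c'" "w \<noteq> c"
      using join_reducible_other_lower_cover by blast
    then show False
      using fwd c c' \<open>c < q\<close> unfolding forced_upward_def by blast
  qed
  have "a \<le> c'" using a c'(2) by blast
  have "\<not> a \<le> c" using a \<open>c \<le> q\<close> by blast
  then have "c < c \<squnion> a" by (metis less_le sup.cobounded1 sup.cobounded2)
  moreover have "c \<squnion> a \<le> c'" using \<open>a \<le> c'\<close> \<open>c < c'\<close> by auto
  ultimately have "c' = c \<squnion> a"
    using c(2) unfolding covered_by_def by (metis order.strict_iff_order)
  then have "a = c'"
    using irr \<open>c < c'\<close> unfolding join_irreducible_def by (metis order.irrefl)
  then show "a \<in> C" "join_irreducible a" using c' irr by auto
qed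

text \<open>Let \<open>d\<close> be the least element of \<open>C\<close> above \<open>x\<close>. If
  \<open>x\<close> were incomparable with some element of \<open>C\<close>, then \<open>d\<close>
  would be the join of \<open>x\<close> and the lower cover of \<open>d\<close> on \<open>C\<close>,
  and irreducibility would give \<open>x = d\<close>.\<close>

lemma maximal_chain_down_closed:
  fixes C :: "'a::{finite, lattice} set"
  assumes C: "maximal_chain C" and "c \<in> C"
    and "\<And>d. d \<in> C \<Longrightarrow> d \<le> c \<Longrightarrow> join_irreducible d" and "x \<le> c"
  shows "x \<in> C"
proof -
  have "finite {d\<in>C. x \<le> d}" "{d\<in>C. x \<le> d} \<noteq> {}" using assms by auto
  then obtain d where d: "d \<in> C" "x \<le> d" and min: "\<And>e. e \<in> C \<Longrightarrow> x \<le> e \<Longrightarrow> e \<le> d \<Longrightarrow> d = e"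
    using finite_has_minimal[of "{d\<in>C. x \<le> d}"] by auto
  have le: "d \<le> e" if "e \<in> C" "x \<le> e" for e
    using maximal_chain_linear[OF C that(1) d(1)] min[OF that] by auto
  show ?thesis
  proof (rule maximal_chain_memI[OF C])
    fix y assume y: "y \<in> C"
    show "y \<le> x \<or> x \<le> y"
    proof (rule ccontr)
      assume n: "\<not> (y \<le> x \<or> x \<le> y)"
      then have "y < d" using maximal_chain_linear[OF C y d(1)] d by (auto simp: less_le)
      then obtain e where e: "e \<in> C" "covered_by e d"
        using maximal_chain_lower_cover[OF C d(1)] y by blast
      then have "e < d" unfolding covered_by_def by simp
      then have "\<not> x \<le> e" using le[OF e(1)] by auto
      then have "e < e \<squnion> x" by (metis less_le sup.cobounded1 sup.cobounded2)
      moreover have "e \<squnion> x \<le> d" using d \<open>e < d\<close> by auto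
      ultimately have "d = e \<squnion> x"
        using e(2) unfolding covered_by_def by (metis order.strict_iff_order)
      moreover have "join_irreducible d" using assms(2,3,4) d(1) le by blast
      ultimately have "d = e \<or> d = x" unfolding join_irreducible_def by blast
      then have "d = x" using \<open>e < d\<close> by auto
      then show False using n \<open>y < d\<close> by auto
    qed
  qed
qed

lemma pseudo_t_norm_of_forced_upward:
  fixes C :: "'a::{finite, bounded_lattice} set"
  assumes modular: "modular_lattice TYPE('a)" and od: "one_distributive TYPE('a)"
    and C: "maximal_chain C" and fwd: "forced_upward C" and unique: "\<exists>!q. q \<in> C \<inter> bi_irreducibles"
    and red: "\<not> join_irreducible (\<top> :: 'a)"
  shows "\<exists>T :: 'a \<Rightarrow> 'a \<Rightarrow> 'a. pseudo_t_norm T \<and> join_distributive T"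
proof -
  note bounds = maximal_chain_bounds[OF C]
  obtain q0 where "covered_by q0 (\<top> :: 'a)"
    using join_reducible_other_lower_cover[OF red] by blast
  then have "\<bottom> < (\<top> :: 'a)" unfolding covered_by_def by (metis bot_least order_le_less_trans)
  then obtain p where p: "p \<in> C" "covered_by p \<top>"
    using maximal_chain_lower_cover[OF C bounds(2)] bounds(1) by blast
  have coatom_le: "x = y" if "covered_by x \<top>" "covered_by y \<top>" "x \<le> y" for x y :: 'a
    using that unfolding covered_by_def by (metis order.strict_iff_order)
  have notin: "q \<notin> C" if "covered_by q \<top>" "q \<noteq> p" for q
    using maximal_chain_linear[OF C _ p(1)] coatom_le that p(2) by metis
  obtain q where q: "covered_by q \<top>" "q \<noteq> p"
    using join_reducible_other_lower_cover[OF red] by blast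
  obtain a where a: "\<And>x. a \<le> x \<longleftrightarrow> \<not> x \<le> q"
    using coatom_least_not_below[OF od q(1)] by blast
  obtain b where b: "\<And>x. b \<le> x \<longleftrightarrow> \<not> x \<le> p"
    using coatom_least_not_below[OF od p(2)] by blast
  note aC = least_not_below_coatom_in_chain[OF C fwd q(1) notin[OF q] a]
  have third: "s = p \<or> s = q" if s: "covered_by s \<top>" for s
  proof (rule ccontr)
    assume n: "\<not> (s = p \<or> s = q)"
    obtain e where e: "\<And>x. e \<le> x \<longleftrightarrow> \<not> x \<le> s"
      using coatom_least_not_below[OF od s] by blast
    have "e \<in> C"
      using least_not_below_coatom_in_chain(1)[OF C fwd s notin[OF s] e] n by blast
    then have "a \<le> e \<or> e \<le> a" using maximal_chain_linear[OF C aC(1)] by blast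
    moreover have "a \<le> s" "e \<le> q" using a e coatom_le s q n by metis+
    \<comment> \<open>\<open>a \<le> s\<close> but \<open>\<not> e \<le> s\<close>, and \<open>e \<le> q\<close> but \<open>\<not> a \<le> q\<close>, so \<open>a\<close> and \<open>e\<close> cannot be comparable.\<close>
    ultimately show False using a e by metis
  qed
  have ab: "a \<squnion> b = \<top>"
  proof (rule ccontr)
    assume "a \<squnion> b \<noteq> \<top>"
    then obtain s where "covered_by s \<top>" "a \<squnion> b \<le> s"
      using covered_by_exists(2)[of "a \<squnion> b" \<top>] by (auto simp: less_le)
    then show False using third[of s] a b by (metis le_sup_iff order_refl)
  qed
  have "a < \<top>" using aC(2) red by (metis top.not_eq_extremum)
  then obtain k where k: "k \<in> C \<inter> bi_irreducibles" "a \<le> k"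
    using bi_irreducible_between[OF C fwd aC bounds(2) red] by blast
  \<comment> \<open>Going up from \<bottom>, a join-reducible \<open>d\<close> below
    \<open>a\<close> would yield a bi-irreducible element strictly below \<open>d\<close>, hence a
    second one besides \<open>k\<close>, which is above \<open>a\<close>.\<close>
  have irr: "join_irreducible d" if dC: "d \<in> C" and da: "d \<le> a" for d
  proof (rule ccontr)
    assume d: "\<not> join_irreducible d"
    have "join_irreducible (\<bottom> :: 'a)" unfolding join_irreducible_def by (metis sup_bot.eq_neutr_iff)
    then have "\<bottom> < d" using d by (metis bot.not_eq_extremum)
    then obtain l where "l \<in> C \<inter> bi_irreducibles" "l < d"
      using bi_irreducible_between[OF C fwd bounds(1) \<open>join_irreducible \<bottom>\<close> dC d] by blast
    then show False using unique k da by (metis leD order_trans)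
  qed
  have down: "x \<in> C" if "x \<le> a" for x
    using maximal_chain_down_closed[OF C aC(1) irr that] .
  show ?thesis
  proof (rule pseudo_t_norm_of_chain_ideal[OF modular])
    show "(x \<sqinter> a) \<squnion> (x \<sqinter> b) = x" for x
    proof -
      have "x \<sqinter> (a \<squnion> b) = (x \<sqinter> a) \<squnion> (x \<sqinter> b)"
        using od ab unfolding one_distributive_def by blast
      then show ?thesis using ab by simp
    qed
    show "join_prime a" "join_prime b"
      using join_prime_if_least_not_below a b by blast+
    show "x \<le> y \<or> y \<le> x" if "x \<le> a" "y \<le> a" for x y
      using maximal_chain_linear[OF C] down that by blast
  qed
qed

subsection \<open>Planar diagrams\<close>

lemma closed_segment_height:
  fixes u v z :: "real \<times> real"
  assumes "z \<in> closed_segment u v" and "snd u < snd v"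
  shows "snd u \<le> snd z" "snd z \<le> snd v"
    and "snd z = snd u \<Longrightarrow> z = u" "snd z = snd v \<Longrightarrow> z = v"
    and "z' \<in> closed_segment u v \<Longrightarrow> snd z' = snd z \<Longrightarrow> z' = z"
proof -
  obtain t where t: "0 \<le> t" "t \<le> 1" "z = (1 - t) *\<^sub>R u + t *\<^sub>R v"
    using assms(1) unfolding in_segment by blast
  have z: "snd z = snd u + t * (snd v - snd u)"
    unfolding t(3) by (simp add: algebra_simps)
  show "snd u \<le> snd z" using z t(1) assms(2) by simp
  have "snd z = snd v - (1 - t) * (snd v - snd u)" using z by (simp add: algebra_simps)
  moreover have "0 \<le> (1 - t) * (snd v - snd u)" using t(2) assms(2) by simp
  ultimately show "snd z \<le> snd v" by linarith
  show "z = u" if "snd z = snd u"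
    using z that assms(2) t(3) by simp
  show "z = v" if "snd z = snd v"
  proof -
    have "(1 - t) * (snd v - snd u) = 0" using z that by (simp add: algebra_simps)
    then show ?thesis using assms(2) t(3) by simp
  qed
  show "z' = z" if z': "z' \<in> closed_segment u v" "snd z' = snd z"
  proof -
    obtain t' where t': "z' = (1 - t') *\<^sub>R u + t' *\<^sub>R v"
      using z'(1) unfolding in_segment by blast
    have "snd z' = snd u + t' * (snd v - snd u)"
      unfolding t' by (simp add: algebra_simps)
    then have "t' = t" using z z'(2) assms(2) by simp
    then show ?thesis using t t' by simp
  qed
qed

lemma closed_segment_point_at_height:
  fixes u v :: "real \<times> real"
  assumes "snd u \<le> h" "h \<le> snd v" "snd u < snd v"
  shows "\<exists>z\<in>closed_segment u v. snd z = h"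
proof -
  define t where "t = (h - snd u) / (snd v - snd u)"
  define z where "z = (1 - t) *\<^sub>R u + t *\<^sub>R v"
  have "0 \<le> t" "t \<le> 1" using assms by (simp_all add: t_def field_simps)
  then have "z \<in> closed_segment u v" unfolding in_segment z_def by blast
  moreover have "snd z = snd u + t * (snd v - snd u)" by (simp add: z_def algebra_simps)
  then have "snd z = h" using assms by (simp add: t_def)
  ultimately show ?thesis by blast
qed

text \<open>Carries planarity from open to closed segments: no vertex lies inside an edge, so a
  point shared by distinct edges is an end point of both.\<close>

lemma edges_meet_at_common_vertex:
  assumes planar: "planar_diagram pos" and "covered_by a b" "covered_by c d"
    and z: "z \<in> closed_segment (pos a) (pos b)" "z \<in> closed_segment (pos c) (pos d)"
  shows "(a, b) = (c, d) \<or> (\<exists>e \<in> {a, b} \<inter> {c, d}. z = pos e)"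
proof (rule ccontr)
  assume n: "\<not> ?thesis"
  have hasse: "hasse_diagram pos" using planar unfolding planar_diagram_def by blast
  then have inj: "pos x = pos y \<longleftrightarrow> x = y" for x y
    unfolding hasse_diagram_def by (auto simp: inj_def)
  have vertex: "pos x \<notin> open_segment (pos a) (pos b)" "pos x \<notin> open_segment (pos c) (pos d)" for x
    using hasse assms(2,3) unfolding hasse_diagram_def by blast+
  have "open_segment (pos a) (pos b) \<inter> open_segment (pos c) (pos d) = {}"
    using planar assms(2,3) n unfolding planar_diagram_def by blast
  moreover have "z \<in> open_segment (pos a) (pos b) \<or> z = pos a \<or> z = pos b"
    using z(1) unfolding open_segment_def by blast
  moreover have "z \<in> open_segment (pos c) (pos d) \<or> z = pos c \<or> z = pos d"
    using z(2) unfolding open_segment_def by blast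
  ultimately have "(z = pos a \<or> z = pos b) \<and> (z = pos c \<or> z = pos d)"
    using vertex by blast
  then show False using n inj by auto
qed

section \<open>The two sides of a drawn chain\<close>

definition weakly_left :: "(real \<times> real) set \<Rightarrow> real \<times> real \<Rightarrow> bool" where
  "weakly_left P z \<longleftrightarrow> (\<exists>w\<in>P. snd w = snd z \<and> fst z \<le> fst w)"

definition weakly_right :: "(real \<times> real) set \<Rightarrow> real \<times> real \<Rightarrow> bool" where
  "weakly_right P z \<longleftrightarrow> (\<exists>w\<in>P. snd w = snd z \<and> fst w \<le> fst z)"

text \<open>The set is the Minkowski sum of the compact set \<open>P\<close> and a closed horizontal
  ray.\<close>

lemma closed_weakly_left:
  assumes "compact P"
  shows "closed {z. weakly_left P z}"
proof -
  have "closed {v :: real \<times> real. snd v = 0 \<and> fst v \<le> 0}"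
    by (intro closed_Collect_conj closed_Collect_eq closed_Collect_le continuous_intros)
  moreover have "{z. weakly_left P z} = (\<Union>x\<in>P. \<Union>y\<in>{v. snd v = 0 \<and> fst v \<le> 0}. {x + y})"
    (is "?L = ?R")
  proof
    show "?L \<subseteq> ?R"
    proof
      fix z assume "z \<in> ?L"
      then obtain w where w: "w \<in> P" "snd w = snd z" "fst z \<le> fst w"
        unfolding weakly_left_def by blast
      then have "z = w + (z - w)" "snd (z - w) = 0" "fst (z - w) \<le> 0" by auto
      then show "z \<in> ?R" using w(1) by blast
    qed
    show "?R \<subseteq> ?L" unfolding weakly_left_def by force
  qed
  ultimately show ?thesis using compact_closed_sums[OF assms] by simp
qed

lemma closed_weakly_right:
  assumes "compact P"
  shows "closed {z. weakly_right P z}"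
proof -
  have "closed {v :: real \<times> real. snd v = 0 \<and> 0 \<le> fst v}"
    by (intro closed_Collect_conj closed_Collect_eq closed_Collect_le continuous_intros)
  moreover have "{z. weakly_right P z} = (\<Union>x\<in>P. \<Union>y\<in>{v. snd v = 0 \<and> 0 \<le> fst v}. {x + y})"
    (is "?L = ?R")
  proof
    show "?L \<subseteq> ?R"
    proof
      fix z assume "z \<in> ?L"
      then obtain w where w: "w \<in> P" "snd w = snd z" "fst w \<le> fst z"
        unfolding weakly_right_def by blast
      then have "z = w + (z - w)" "snd (z - w) = 0" "0 \<le> fst (z - w)" by auto
      then show "z \<in> ?R" using w(1) by blast
    qed
    show "?R \<subseteq> ?L" unfolding weakly_right_def by force
  qed
  ultimately show ?thesis using compact_closed_sums[OF assms] by simp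
qed

text \<open>In the one-element lattice the only maximal chain has an empty \<open>chain_path\<close>.\<close>

locale planar_lattice =
  fixes pos :: "'a::{finite, bounded_lattice} \<Rightarrow> real \<times> real"
  assumes planar: "planar_diagram pos" and nontrivial: "\<bottom> \<noteq> (\<top> :: 'a)"
begin

abbreviation height :: "'a \<Rightarrow> real" where
  "height x \<equiv> snd (pos x)"

abbreviation edge :: "'a \<Rightarrow> 'a \<Rightarrow> (real \<times> real) set" where
  "edge a b \<equiv> closed_segment (pos a) (pos b)"

lemma height_less: "a < b \<Longrightarrow> height a < height b"
  using planar unfolding planar_diagram_def hasse_diagram_def by blast

lemma height_le: "a \<le> b \<Longrightarrow> height a \<le> height b"
  using height_less[of a b] by (cases "a = b") (auto simp: less_le)

lemma height_covered: "covered_by a b \<Longrightarrow> height a < height b"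
  using height_less unfolding covered_by_def by blast

lemma chain_pathE:
  assumes "z \<in> chain_path pos C"
  obtains a b where "a \<in> C" "b \<in> C" "covered_by a b" "z \<in> edge a b"
  using assms unfolding chain_path_def by blast

lemma edge_subset_chain_path:
  "a \<in> C \<Longrightarrow> b \<in> C \<Longrightarrow> covered_by a b \<Longrightarrow> edge a b \<subseteq> chain_path pos C"
  unfolding chain_path_def by blast

lemma compact_chain_path: "compact (chain_path pos C)"
proof -
  have "chain_path pos C = (\<Union>(a, b)\<in>{(a, b). a \<in> C \<and> b \<in> C \<and> covered_by a b}. edge a b)"
    unfolding chain_path_def by blast
  then show ?thesis by (auto intro!: compact_UN)
qed

text \<open>Of two distinct edges of a chain one ends at or below the start of the other, so they
  share a height only at a common vertex; within one edge the height determines the point.\<close>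

lemma chain_path_unique:
  assumes C: "maximal_chain C" and z: "z \<in> chain_path pos C" "z' \<in> chain_path pos C"
    and eq: "snd z = snd z'"
  shows "z = z'"
proof -
  have *: "w = w'" if "covered_by a b" "covered_by a' b'" "b \<le> a'" "w \<in> edge a b" "w' \<in> edge a' b'"
    "snd w = snd w'" for a b a' b' w w'
  proof -
    note s = closed_segment_height[OF that(4) height_covered[OF that(1)]]
      closed_segment_height[OF that(5) height_covered[OF that(2)]]
    have "height b = height a'" using s(2,6) height_le[OF that(3)] that(6) by linarith
    then have "b = a'" using height_less[of b a'] that(3) by (auto simp: less_le)
    then show ?thesis using s that(6) by (metis antisym)
  qed
  obtain a b where ab: "a \<in> C" "b \<in> C" "covered_by a b" "z \<in> edge a b"
    using z(1) by (rule chain_pathE)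
  obtain a' b' where ab': "a' \<in> C" "b' \<in> C" "covered_by a' b'" "z' \<in> edge a' b'"
    using z(2) by (rule chain_pathE)
  have "b \<le> a' \<or> b' \<le> a \<or> a = a' \<and> b = b'"
    using maximal_chain_linear[OF C ab(1) ab'(1)] maximal_chain_linear[OF C ab(1) ab'(2)]
      maximal_chain_linear[OF C ab(2) ab'(1)] maximal_chain_linear[OF C ab(2) ab'(2)]
      ab(3) ab'(3) unfolding covered_by_def by (metis order.strict_iff_order)
  then consider "b \<le> a'" | "b' \<le> a" | "a = a'" "b = b'" by blast
  then show ?thesis
  proof cases
    case 1
    then show ?thesis using *[OF ab(3) ab'(3) _ ab(4) ab'(4) eq] by blast
  next
    case 2
    then show ?thesis using *[OF ab'(3) ab(3) _ ab'(4) ab(4) eq[symmetric]] by simp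
  next
    case 3
    then show ?thesis
      using closed_segment_height(5)[OF ab(4) height_covered[OF ab(3)], of z'] ab'(4) eq by simp
  qed
qed

lemma chain_path_at_height:
  assumes C: "maximal_chain C" and h: "height \<bottom> \<le> h" "h \<le> height \<top>"
  shows "\<exists>a\<in>C. \<exists>b\<in>C. covered_by a b \<and> (\<exists>z\<in>edge a b. snd z = h)"
proof -
  note bounds = maximal_chain_bounds[OF C]
  have "\<bottom> < (\<top> :: 'a)" using nontrivial by (simp add: less_le)
  \<comment> \<open>Demanding \<open>\<bottom> < b\<close> secures a lower cover on \<open>C\<close>
    even when \<open>h\<close> is the height of \<bottom>.\<close>
  then obtain b where b: "b \<in> C" "\<bottom> < b" "h \<le> height b"
    and min: "\<And>d. d \<in> C \<Longrightarrow> \<bottom> < d \<Longrightarrow> h \<le> height d \<Longrightarrow> d \<le> b \<Longrightarrow> b = d"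
    using finite_has_minimal[of "{b\<in>C. \<bottom> < b \<and> h \<le> height b}"] bounds h(2) by auto
  obtain a where a: "a \<in> C" "covered_by a b"
    using maximal_chain_lower_cover[OF C b(1)] bounds(1) b(2) by blast
  then have "a < b" unfolding covered_by_def by simp
  then have "\<not> (\<bottom> < a \<and> h \<le> height a)" using min[OF a(1)] by force
  then have "height a \<le> h" using h(1) by (cases "a = \<bottom>") (auto simp: less_le)
  then show ?thesis
    using closed_segment_point_at_height[OF _ b(3) height_covered[OF a(2)]] a b by blast
qed

lemma edge_height_bounds:
  assumes "z \<in> edge a b" "covered_by a b"
  shows "height \<bottom> \<le> snd z" "snd z \<le> height \<top>"
  using closed_segment_height(1,2)[OF assms(1) height_covered[OF assms(2)]]
    height_le[of \<bottom> a] height_le[of b \<top>] by auto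

lemma vertex_height_bounds: "height \<bottom> \<le> height x" "height x \<le> height \<top>"
  by (simp_all add: height_le)

lemma weakly_left_or_right:
  assumes C: "maximal_chain C" and h: "height \<bottom> \<le> snd z" "snd z \<le> height \<top>"
  shows "weakly_left (chain_path pos C) z \<or> weakly_right (chain_path pos C) z"
proof -
  obtain w where "w \<in> chain_path pos C" "snd w = snd z"
    using chain_path_at_height[OF C h] edge_subset_chain_path by blast
  then show ?thesis
    unfolding weakly_left_def weakly_right_def using linear[of "fst z" "fst w"] by blast
qed

lemma on_chain_path:
  assumes C: "maximal_chain C" and "weakly_left (chain_path pos C) z"
    and "weakly_right (chain_path pos C) z"
  shows "z \<in> chain_path pos C"
proof -
  obtain w w' where w: "w \<in> chain_path pos C" "snd w = snd z" "fst z \<le> fst w"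
    and w': "w' \<in> chain_path pos C" "snd w' = snd z" "fst w' \<le> fst z"
    using assms(2,3) unfolding weakly_left_def weakly_right_def by blast
  then have "w = w'" using chain_path_unique[OF C] by simp
  then have "z = w" using w w' by (auto simp: prod_eq_iff)
  then show ?thesis using w by simp
qed

text \<open>A connected segment is not the disjoint union of two nonempty closed sides, so some
  point lies on both, and such points are on the path.\<close>

lemma edge_crosses_chain_path:
  assumes C: "maximal_chain C" and ab: "covered_by a b" and z: "z \<in> edge a b" "z' \<in> edge a b"
    and lr: "weakly_left (chain_path pos C) z" "weakly_right (chain_path pos C) z'"
  shows "\<exists>w\<in>closed_segment z z'. w \<in> chain_path pos C"
proof (rule ccontr)
  let ?P = "chain_path pos C"
  assume n: "\<not> ?thesis"
  have "\<not> ({w. weakly_left ?P w} \<inter> closed_segment z z' \<noteq> {} \<and>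
      {w. weakly_right ?P w} \<inter> closed_segment z z' \<noteq> {})"
  proof
    assume ne: "{w. weakly_left ?P w} \<inter> closed_segment z z' \<noteq> {} \<and>
      {w. weakly_right ?P w} \<inter> closed_segment z z' \<noteq> {}"
    have "closed_segment z z' \<subseteq> edge a b"
      using z by (simp add: closed_segment_subset)
    then have "closed_segment z z' \<subseteq> {w. weakly_left ?P w} \<union> {w. weakly_right ?P w}"
      using weakly_left_or_right[OF C] edge_height_bounds[OF _ ab] by blast
    moreover have "{w. weakly_left ?P w} \<inter> {w. weakly_right ?P w} \<inter> closed_segment z z' = {}"
      using n on_chain_path[OF C] by blast
    ultimately show False
      using connected_closedD[OF connected_segment(1)[of z z'], of "{w. weakly_left ?P w}"
          "{w. weakly_right ?P w}"] ne closed_weakly_left[OF compact_chain_path, of C]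
        closed_weakly_right[OF compact_chain_path, of C] by blast
  qed
  then show False using lr by blast
qed

lemma vertex_on_chain_path:
  assumes C: "maximal_chain C"
  shows "pos x \<in> chain_path pos C \<longleftrightarrow> x \<in> C"
proof
  assume x: "x \<in> C"
  note bounds = maximal_chain_bounds[OF C]
  show "pos x \<in> chain_path pos C"
  proof (cases "x = \<top>")
    case True
    then have "\<bottom> < x" using nontrivial by (simp add: less_le)
    then obtain c where "c \<in> C" "covered_by c x"
      using maximal_chain_lower_cover[OF C x] bounds by blast
    then show ?thesis using edge_subset_chain_path[of c C x] x by auto
  next
    case False
    then have "x < \<top>" by (simp add: less_le)
    then obtain c where "c \<in> C" "covered_by x c"
      using maximal_chain_upper_cover[OF C x] bounds by blast
    then show ?thesis using edge_subset_chain_path[of x C c] x by auto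
  qed
next
  assume "pos x \<in> chain_path pos C"
  then obtain a b where ab: "a \<in> C" "b \<in> C" "covered_by a b" "pos x \<in> edge a b"
    by (rule chain_pathE)
  have hasse: "hasse_diagram pos" using planar unfolding planar_diagram_def by blast
  then have "pos x \<notin> open_segment (pos a) (pos b)" "inj pos"
    using ab unfolding hasse_diagram_def by blast+
  then have "pos x = pos a \<or> pos x = pos b" using ab(4) unfolding open_segment_def by blast
  then show "x \<in> C" using ab \<open>inj pos\<close> by (auto dest: injD)
qed

lemma edge_meets_chain_path:
  assumes ab: "covered_by a b" and z: "z \<in> edge a b" "z \<in> chain_path pos C"
  shows "a \<in> C \<and> b \<in> C \<or> a \<in> C \<and> z = pos a \<or> b \<in> C \<and> z = pos b"
proof -
  obtain c d where cd: "c \<in> C" "d \<in> C" "covered_by c d" "z \<in> edge c d"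
    using z(2) by (rule chain_pathE)
  show ?thesis
    using edges_meet_at_common_vertex[OF planar ab cd(3) z(1) cd(4)] cd by auto
qed

text \<open>A discrete intermediate value theorem: climb from \<open>x\<close> to \<open>y\<close>
  by covers. The first edge that changes sides crosses the path, which by planarity puts one of its
  ends on \<open>C\<close>.\<close>

lemma interval_meets_chain:
  assumes C: "maximal_chain C" and "x \<le> y"
    and "weakly_left (chain_path pos C) (pos x)" "weakly_right (chain_path pos C) (pos y)"
  shows "\<exists>d\<in>C. x \<le> d \<and> d \<le> y"
  using assms(2,3)
proof (induction "card {x..y}" arbitrary: x rule: less_induct)
  case less
  show ?case
  proof (cases "x = y")
    case True
    then have "x \<in> C"
      using on_chain_path[OF C less.prems(2)] assms(4) vertex_on_chain_path[OF C] by simp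
    then show ?thesis using less.prems(1) by blast
  next
    case False
    then obtain x' where x': "covered_by x x'" "x' \<le> y"
      using covered_by_exists(1)[of x y] less.prems(1) by (auto simp: less_le)
    then have "x < x'" unfolding covered_by_def by simp
    have "weakly_left (chain_path pos C) (pos x') \<or> weakly_right (chain_path pos C) (pos x')"
      by (rule weakly_left_or_right[OF C]) (rule vertex_height_bounds)+
    then show ?thesis
    proof
      assume left: "weakly_left (chain_path pos C) (pos x')"
      have "{x'..y} \<subset> {x..y}" using \<open>x < x'\<close> less.prems(1) by auto
      then have "card {x'..y} < card {x..y}" by (simp add: psubset_card_mono)
      then obtain d where "d \<in> C" "x' \<le> d" "d \<le> y" using less.hyps x'(2) left by blast
      then show ?thesis using \<open>x < x'\<close> by (meson less_imp_le order_trans)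
    next
      assume "weakly_right (chain_path pos C) (pos x')"
      then obtain w where w: "w \<in> edge x x'" "w \<in> chain_path pos C"
        using edge_crosses_chain_path[OF C x'(1) _ _ less.prems(2), of "pos x'"]
        by (meson ends_in_segment(1,2))
      then have "x \<in> C \<or> x' \<in> C" using edge_meets_chain_path[OF x'(1)] by blast
      then show ?thesis using \<open>x < x'\<close> x'(2) by (meson less_imp_le order_refl order_trans)
    qed
  qed
qed

section \<open>The left boundary\<close>

lemma left_boundary_vertex:
  assumes C: "left_boundary_chain pos C" and w: "w \<in> chain_path pos C" "snd w = height x"
  shows "fst w \<le> fst (pos x)"
  using C w unfolding left_boundary_chain_def strictly_left_of_def by (metis not_le)

text \<open>The boundary condition constrains vertices only. If an edge point were strictly left of
  the path, both halves of the edge would cross the path on the way to its ends; by planarity this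
  puts \<open>a\<close> and \<open>b\<close> on \<open>C\<close>, so the whole edge is part of the
  path.\<close>

lemma left_boundary_edge:
  assumes bd: "left_boundary_chain pos C" and ab: "covered_by a b" and z: "z \<in> edge a b"
    and w: "w \<in> chain_path pos C" "snd w = snd z"
  shows "fst w \<le> fst z"
proof (rule ccontr)
  let ?P = "chain_path pos C"
  assume n: "\<not> fst w \<le> fst z"
  have C: "maximal_chain C" using bd unfolding left_boundary_chain_def by blast
  have lt: "height a < height b" using height_covered[OF ab] .
  have notin: "z \<notin> ?P" using chain_path_unique[OF C w(1) _ w(2)] n by auto
  have left: "weakly_left ?P z" unfolding weakly_left_def using w n by force
  have right: "weakly_right ?P (pos x)" for x
  proof -
    obtain v where "v \<in> ?P" "snd v = height x"
      using chain_path_at_height[OF C vertex_height_bounds] edge_subset_chain_path by blast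
    then show ?thesis unfolding weakly_right_def using left_boundary_vertex[OF bd] by blast
  qed
  have "a \<in> C \<and> b \<in> C"
  proof (rule ccontr)
    assume nab: "\<not> (a \<in> C \<and> b \<in> C)"
    obtain u where u: "u \<in> closed_segment z (pos a)" "u \<in> ?P"
      using edge_crosses_chain_path[OF C ab z _ left right[of a]] by auto
    obtain v where v: "v \<in> closed_segment z (pos b)" "v \<in> ?P"
      using edge_crosses_chain_path[OF C ab z _ left right[of b]] by auto
    have sub: "closed_segment z (pos a) \<subseteq> edge a b" "closed_segment z (pos b) \<subseteq> edge a b"
      using z by (simp_all add: closed_segment_subset)
    have zne: "z \<noteq> pos a" "z \<noteq> pos b" using notin nab u v by auto
    have h: "height a < snd z" "snd z < height b"
      using closed_segment_height[OF z lt] zne by (auto simp: less_le)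
    have "snd u \<le> snd z"
      using closed_segment_height(2)[of u "pos a" z] u(1) h by (simp add: closed_segment_commute)
    moreover have "snd z \<le> snd v"
      using closed_segment_height(1)[of v z "pos b"] v(1) h by simp
    ultimately have "u \<noteq> pos b" "v \<noteq> pos a" using h by auto
    then show False
      using edge_meets_chain_path[OF ab _ u(2)] edge_meets_chain_path[OF ab _ v(2)]
        u(1) v(1) sub nab by blast
  qed
  then have "z \<in> ?P" using edge_subset_chain_path ab z by blast
  then show False using notin by blast
qed

text \<open>\<open>D\<close> is a detour through \<open>w\<close>. As \<open>C\<close> is leftmost,
  \<open>c\<close> is weakly left of \<open>D\<close>, so the interval from \<open>c\<close> to
  \<open>y\<close> meets \<open>D\<close> in some \<open>d\<close>. It is not below
  \<open>w\<close>, or \<open>w\<close> would lie strictly between \<open>c\<close> and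
  \<open>c'\<close>; hence \<open>c' \<le> d\<close>.\<close>

lemma left_boundary_forced_upward_high:
  assumes bd: "left_boundary_chain pos C" and c: "c \<in> C" "c' \<in> C" "covered_by c c'"
    and w: "covered_by w c'" "w \<noteq> c"
    and D: "maximal_chain D" "w \<in> D" "c' \<in> D" "\<And>x. x \<in> C \<Longrightarrow> c' \<le> x \<Longrightarrow> x \<in> D"
    and y: "c < y" "weakly_right (chain_path pos D) (pos y)"
  shows "c' \<le> y"
proof -
  have C: "maximal_chain C" using bd unfolding left_boundary_chain_def by blast
  obtain a b z where ab: "a \<in> D" "b \<in> D" "covered_by a b" "z \<in> edge a b" "snd z = height c"
    using chain_path_at_height[OF D(1) vertex_height_bounds] by blast
  have "pos c \<in> chain_path pos C" using vertex_on_chain_path[OF C] c(1) by blast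
  then have "fst (pos c) \<le> fst z"
    using left_boundary_edge[OF bd ab(3,4)] ab(5) by metis
  then have "weakly_left (chain_path pos D) (pos c)"
    unfolding weakly_left_def using edge_subset_chain_path[OF ab(1-3)] ab(4,5) by blast
  then obtain d where d: "d \<in> D" "c \<le> d" "d \<le> y"
    using interval_meets_chain[OF D(1) _ _ y(2)] y(1) by (meson less_imp_le)
  have "d \<le> w \<or> c' \<le> d"
    using maximal_chain_linear[OF D(1) d(1) D(2)] maximal_chain_linear[OF D(1) d(1) D(3)] w(1)
    unfolding covered_by_def by (metis order.strict_iff_order)
  moreover have "\<not> d \<le> w"
  proof
    assume "d \<le> w"
    then have "c < w" "w < c'" using d(2) w unfolding covered_by_def by auto
    then show False using c(3) unfolding covered_by_def by blast
  qed
  ultimately show ?thesis using d(3) by (meson order_trans)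
qed

text \<open>The detour \<open>D\<close> passes through \<open>w\<close> to \<open>c'\<close> and
  agrees with \<open>C\<close> from there on. Elements weakly right of \<open>D\<close> are already
  settled; it remains to rule out, strictly left of \<open>D\<close>, elements above
  \<open>c\<close> but not above \<open>c'\<close>.\<close>

lemma left_boundary_forced_upward:
  assumes bd: "left_boundary_chain pos C"
  shows "forced_upward C"
  unfolding forced_upward_def
proof (intro ballI allI impI)
  fix c c' w y
  assume c: "c \<in> C" "c' \<in> C" "covered_by c c'" and w: "covered_by w c'" "w \<noteq> c" and y: "c < y"
  have C: "maximal_chain C" using bd unfolding left_boundary_chain_def by blast
  have "w < c'" "c < c'" using w c unfolding covered_by_def by auto
  then have lin: "x \<le> z \<or> z \<le> x" if "x \<in> insert w {x\<in>C. c' \<le> x}" "z \<in> insert w {x\<in>C. c' \<le> x}" for x z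
    using that maximal_chain_linear[OF C] by fastforce
  then obtain D where D: "maximal_chain D" "insert w {x\<in>C. c' \<le> x} \<subseteq> D"
    using maximal_chain_extends[of "insert w {x\<in>C. c' \<le> x}"] by blast
  have up: "x \<in> D" if "x \<in> C" "c' \<le> x" for x
    using D that by auto
  have cD: "c' \<in> D" and wD: "w \<in> D" using D c by auto
  note high = left_boundary_forced_upward_high[OF bd c w D(1) wD cD up]
  have DC: "d \<in> C" if "d \<in> D" "c' \<le> d" for d
  proof (rule maximal_chain_memI[OF C])
    fix x assume x: "x \<in> C"
    show "x \<le> d \<or> d \<le> x"
      using maximal_chain_linear[OF C x c(2)] up[OF x] maximal_chain_linear[OF D(1) that(1), of x] that(2)
      by (meson order_trans)
  qed
  \<comment> \<open>From the height of \<open>c'\<close> upward the path of \<open>D\<close> is part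
    of the path of \<open>C\<close>.\<close>
  have right: "weakly_right (chain_path pos D) z"
    if z: "covered_by u v" "z \<in> edge u v" "height c' \<le> snd z" for u v z
  proof -
    obtain a b p where ab: "a \<in> D" "b \<in> D" "covered_by a b" "p \<in> edge a b" "snd p = snd z"
      using chain_path_at_height[OF D(1) edge_height_bounds[OF z(2,1)]] by blast
    have p: "p \<in> chain_path pos C"
    proof (cases "c' \<le> a")
      case True
      moreover have "a < b" using ab(3) unfolding covered_by_def by simp
      ultimately have "a \<in> C" "b \<in> C" using DC ab(1,2) by auto
      then show ?thesis using edge_subset_chain_path ab by blast
    next
      case False
      \<comment> \<open>An edge ending at or below \<open>c'\<close> can reach the height of
        \<open>c'\<close> only at its top, which is then \<open>c'\<close> itself.\<close>
      then have "b \<le> c'"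
        using maximal_chain_linear[OF D(1) ab(1) cD] maximal_chain_linear[OF D(1) ab(2) cD] ab(3)
        unfolding covered_by_def by (metis order.strict_iff_order)
      then have "p = pos b" "b = c'"
        using closed_segment_height(2,4)[OF ab(4) height_covered[OF ab(3)]] ab(5) z(3)
          height_le[of b c'] height_less[of b c'] by (auto simp: less_le)
      then show ?thesis using vertex_on_chain_path[OF C] c(2) by blast
    qed
    then have "fst p \<le> fst z" using left_boundary_edge[OF bd z(1,2)] ab(5) by blast
    then show ?thesis
      unfolding weakly_right_def using edge_subset_chain_path[OF ab(1-3)] ab(4,5) by blast
  qed
  show "c' \<le> y"
  proof (rule ccontr)
    assume n: "\<not> c' \<le> y"
    \<comment> \<open>An edge leaving the complement of the up-set of \<open>c'\<close> must pass the height of \<open>c'\<close>, and there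
      it is right of \<open>D\<close>, which coincides with \<open>C\<close> from \<open>c'\<close> on.\<close>
    obtain y' where y': "y \<le> y'" "\<not> c' \<le> y'"
      and max: "\<And>x. y \<le> x \<Longrightarrow> \<not> c' \<le> x \<Longrightarrow> y' \<le> x \<Longrightarrow> y' = x"
      using finite_has_maximal[of "{x. y \<le> x \<and> \<not> c' \<le> x}"] n by auto
    have "c < y'" using y y'(1) by (rule order_less_le_trans)
    then have not_right: "\<not> weakly_right (chain_path pos D) (pos y')" using high y'(2) by blast
    have "y' < \<top>" using y'(2) by (metis top.not_eq_extremum top_greatest)
    then obtain y'' where y'': "covered_by y' y''" using covered_by_exists(1) by blast
    then have "y' < y''" unfolding covered_by_def by simp
    then have "c' \<le> y''" using max[of y''] y'(1) by force
    \<comment> \<open>Equality would put \<open>y'\<close> strictly between \<open>c\<close> and its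
      cover \<open>c'\<close>.\<close>
    moreover have "y'' \<noteq> c'" using c(3) \<open>c < y'\<close> \<open>y' < y''\<close> unfolding covered_by_def by blast
    ultimately have hi: "height c' < height y''" using height_less by (simp add: less_le)
    have lo: "height y' < height c'"
    proof (rule ccontr)
      assume "\<not> height y' < height c'"
      then show False using right[OF y'', of "pos y'"] not_right by simp
    qed
    obtain z where z: "z \<in> edge y' y''" "snd z = height c'"
      using closed_segment_point_at_height[of "pos y'" "height c'" "pos y''"] lo hi by auto
    \<comment> \<open>Up to the height of \<open>c'\<close> the edge runs from the left of
      \<open>D\<close> to its right. It meets \<open>D\<close> below \<open>y''\<close>, so by
      planarity \<open>y'\<close> is on \<open>D\<close> and thus weakly right after all.\<close>
    have "weakly_left (chain_path pos D) (pos y')"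
      using weakly_left_or_right[OF D(1) vertex_height_bounds] not_right by blast
    then obtain v where v: "v \<in> closed_segment (pos y') z" "v \<in> chain_path pos D"
      using edge_crosses_chain_path[OF D(1) y'' _ z(1) _ right[OF y'' z(1)], of "pos y'"] z(2)
      by auto
    have "snd v \<le> snd z" using closed_segment_height(2)[OF v(1)] lo z(2) by simp
    then have "v \<noteq> pos y''" using hi z(2) by auto
    moreover have "v \<in> edge y' y''"
      using v(1) z(1) closed_segment_subset[of "pos y'" "edge y' y''" z] by auto
    ultimately have "y' \<in> D" using edge_meets_chain_path[OF y'' _ v(2)] by blast
    then have "pos y' \<in> chain_path pos D" using vertex_on_chain_path[OF D(1)] by blast
    then show False using not_right unfolding weakly_right_def by blast
  qed
qed

end

section \<open>Reflection of diagrams in the vertical axis\<close>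

definition reflect :: "real \<times> real \<Rightarrow> real \<times> real" where
  "reflect z = (- fst z, snd z)"

lemma fst_reflect [simp]: "fst (reflect z) = - fst z"
  and snd_reflect [simp]: "snd (reflect z) = snd z"
  by (simp_all add: reflect_def)

lemma linear_reflect: "linear reflect"
  by (rule linearI) (simp_all add: reflect_def)

lemma inj_reflect: "inj reflect"
  by (rule injI) (simp add: reflect_def prod_eq_iff)

lemma open_segment_reflect:
  "open_segment (reflect u) (reflect v) = reflect ` open_segment u v"
  using open_segment_linear_image[OF linear_reflect inj_reflect] .

lemma planar_diagram_reflect:
  assumes "planar_diagram pos"
  shows "planar_diagram (reflect \<circ> pos)"
  unfolding planar_diagram_def hasse_diagram_def
proof (intro conjI allI impI)
  have hasse: "hasse_diagram pos" using assms unfolding planar_diagram_def by blast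
  show "inj (reflect \<circ> pos)"
    using hasse inj_reflect inj_compose unfolding hasse_diagram_def by blast
  show "snd ((reflect \<circ> pos) a) < snd ((reflect \<circ> pos) b)" if "a < b" for a b
    using hasse that unfolding hasse_diagram_def by simp
  show "(reflect \<circ> pos) c \<notin> open_segment ((reflect \<circ> pos) a) ((reflect \<circ> pos) b)"
    if "covered_by a b" for a b c
    using hasse that
    unfolding hasse_diagram_def comp_apply open_segment_reflect inj_image_mem_iff[OF inj_reflect]
    by blast
  show "open_segment ((reflect \<circ> pos) a) ((reflect \<circ> pos) b) \<inter>
      open_segment ((reflect \<circ> pos) c) ((reflect \<circ> pos) d) = {}"
    if "covered_by a b" "covered_by c d" "(a, b) \<noteq> (c, d)" for a b c d
  proof -
    have "open_segment (pos a) (pos b) \<inter> open_segment (pos c) (pos d) = {}"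
      using assms that unfolding planar_diagram_def by blast
    then show ?thesis
      unfolding comp_apply open_segment_reflect image_Int[OF inj_reflect, symmetric] by simp
  qed
qed

lemma chain_path_reflect: "chain_path (reflect \<circ> pos) C = reflect ` chain_path pos C"
proof -
  have "chain_path p C = (\<Union>(a, b)\<in>{(a, b). a \<in> C \<and> b \<in> C \<and> covered_by a b}. closed_segment (p a) (p b))"
    for p :: "'a \<Rightarrow> real \<times> real"
    unfolding chain_path_def by blast
  then show ?thesis
    by (simp add: closed_segment_linear_image[OF linear_reflect] image_UN case_prod_unfold)
qed

lemma left_boundary_chain_reflect:
  assumes "right_boundary_chain pos C"
  shows "left_boundary_chain (reflect \<circ> pos) C"
proof -
  have "strictly_left_of (reflect \<circ> pos) C q \<longleftrightarrow> strictly_right_of pos C q" for q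
    unfolding strictly_left_of_def strictly_right_of_def chain_path_reflect by simp
  then show ?thesis
    using assms unfolding left_boundary_chain_def right_boundary_chain_def by blast
qed

lemma ex_join_distributive_pseudo_t_norm:
  fixes pos :: "'a::{finite, bounded_lattice} \<Rightarrow> real \<times> real"
  assumes "planar_diagram pos" and bd: "left_boundary_chain pos C"
    and modular: "modular_lattice TYPE('a)" and od: "one_distributive TYPE('a)"
    and unique: "\<exists>!q. q \<in> C \<inter> bi_irreducibles"
  shows "\<exists>T :: 'a \<Rightarrow> 'a \<Rightarrow> 'a. pseudo_t_norm T \<and> join_distributive T"
proof (cases "join_irreducible (\<top> :: 'a)")
  case True
  then show ?thesis by (rule join_distributive_pseudo_t_norm_if_top_join_irreducible)
next
  case False
  \<comment> \<open>Join-reducibility of \<top> excludes the one-element lattice, so the locale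
    applies.\<close>
  then have "\<bottom> \<noteq> (\<top> :: 'a)"
    unfolding join_irreducible_def by (metis sup_bot.eq_neutr_iff)
  then interpret planar_lattice pos
    using assms(1) by unfold_locales
  have "maximal_chain C" using bd unfolding left_boundary_chain_def by blast
  then show ?thesis
    using pseudo_t_norm_of_forced_upward[OF modular od _ left_boundary_forced_upward[OF bd] unique False]
    by blast
qed

theorem theorem5p2:
  fixes pos :: "'a::{finite, bounded_lattice} \<Rightarrow> real \<times> real"
    and C\<^sub>l C\<^sub>r :: "'a set"
  assumes "CARD('a) \<ge> 2"
    and "planar_diagram pos"
    and "modular_lattice TYPE('a)"
    and "\<not> {\<bottom>, \<top>} \<subseteq> (bi_irreducibles :: 'a set)"
    and "left_boundary_chain pos C\<^sub>l"
    and "right_boundary_chain pos C\<^sub>r"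
    and "(\<exists>!q. q \<in> C\<^sub>l \<inter> bi_irreducibles) \<or> (\<exists>!q. q \<in> C\<^sub>r \<inter> bi_irreducibles)"
  shows "one_distributive TYPE('a) \<longleftrightarrow>
           (\<exists>T :: 'a \<Rightarrow> 'a \<Rightarrow> 'a. pseudo_t_norm T \<and> join_distributive T)"
proof
  assume "\<exists>T :: 'a \<Rightarrow> 'a \<Rightarrow> 'a. pseudo_t_norm T \<and> join_distributive T"
  then show "one_distributive TYPE('a)"
    using pseudo_t_norm_imp_one_distributive by blast
next
  assume od: "one_distributive TYPE('a)"
  show "\<exists>T :: 'a \<Rightarrow> 'a \<Rightarrow> 'a. pseudo_t_norm T \<and> join_distributive T"
    using assms(7)
  proof
    assume "\<exists>!q. q \<in> C\<^sub>l \<inter> bi_irreducibles"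
    then show ?thesis
      by (rule ex_join_distributive_pseudo_t_norm[OF assms(2,5,3) od])
  next
    \<comment> \<open>The right boundary is the left boundary of the mirrored diagram.\<close>
    assume "\<exists>!q. q \<in> C\<^sub>r \<inter> bi_irreducibles"
    then show ?thesis
      by (rule ex_join_distributive_pseudo_t_norm[OF planar_diagram_reflect[OF assms(2)]
            left_boundary_chain_reflect[OF assms(6)] assms(3) od])
  qed
qed

end
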